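(* Let ${\tt w}\in\mathcal{W}$. If one of the limits (in the extended reals $[-\infty,\infty]$) \[r:=\lim_{n\to\infty}\frac{r(n)}{n},\quad p:=\lim_{n\to\infty}\frac{p_{\tt b}(n)}{n},\quad q:=\lim_{n\to\infty}\frac{p_{\tt a}(n)}{n}\] exists, then all of them exist and $\frac1p+\frac1q=1$ (with $1/\infty=0$). Moreover, \[p=\frac{2+r+\sqrt{4+r^2}}{2},\qquad q=\frac{2-r+\sqrt{4+r^2}}{2}\] in the extended reals.
   Context: $\mathcal{W}$ is the set of infinite one-sided words over $\{{\tt a},{\tt b}\}$ (indexed from $0$) in which both letters occur infinitely often. $p_{\tt a}(n)$, $p_{\tt b}(n)$ are the positions of the $n$-th ${\tt a}$ and $n$-th ${\tt b}$, and $r(n)=p_{\tt b}(n)-p_{\tt a}(n)$. *)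

theory Defs
  imports "HOL-Analysis.Analysis"
begin

datatype letter = LetA | LetB

definition words_W :: "(nat \<Rightarrow> letter) set" where
  "words_W = {w. infinite {i. w i = LetA} \<and> infinite {i. w i = LetB}}"

text \<open>Word positions start at 0, while occurrences are counted from 1: the first occurrence
  of a letter has \<open>n = 1\<close>, so the index of \<^const>\<open>enumerate\<close>, which starts at 0,
  is shifted. The argument \<open>n = 0\<close> is meaningless.\<close>

definition nth_pos :: "letter \<Rightarrow> (nat \<Rightarrow> letter) \<Rightarrow> nat \<Rightarrow> nat" where
  "nth_pos x w n = enumerate {i. w i = x} (n - 1)"

definition p_a :: "(nat \<Rightarrow> letter) \<Rightarrow> nat \<Rightarrow> nat" where
  "p_a w n = nth_pos LetA w n"

definition p_b :: "(nat \<Rightarrow> letter) \<Rightarrow> nat \<Rightarrow> nat" where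
  "p_b w n = nth_pos LetB w n"

definition r_diff :: "(nat \<Rightarrow> letter) \<Rightarrow> nat \<Rightarrow> int" where
  "r_diff w n = int (p_b w n) - int (p_a w n)"

text \<open>Value of a real formula at an extended real argument. At infinite arguments it is the
  limit of the formula, which gives a meaning to indeterminate expressions such as
  \<open>2 - r + sqrt (4 + r\<^sup>2)\<close> at \<open>r = \<infinity>\<close>.\<close>

definition ereal_extend :: "(real \<Rightarrow> real) \<Rightarrow> ereal \<Rightarrow> ereal" where
  "ereal_extend f r = (case r of
      ereal x \<Rightarrow> ereal (f x)
    | PInfty \<Rightarrow> Lim at_top (\<lambda>x. ereal (f x))
    | MInfty \<Rightarrow> Lim at_bot (\<lambda>x. ereal (f x)))"

end

theory Submission imports Defs "HOL-Real_Asymp.Real_Asymp" begin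

text \<open>Let \<open>f n\<close>, \<open>g n\<close> be the positions of the \<open>n\<close>-th \<open>b\<close> and \<open>a\<close>, and let \<open>k n = g n + 1 - n\<close>
  be the number of \<open>b\<close>'s before the \<open>n\<close>-th \<open>a\<close>. Then \<open>f (k n) < g n < f (k n + 1)\<close> and
  \<open>k n\<close> tends to infinity, so a limit \<open>p\<close> of \<open>f n / n\<close> is also a limit of \<open>g n / k n = 1 + (n - 1) / k n\<close>,
  which determines the limit of \<open>g n / n\<close>.

  If instead \<open>(f n - g n) / n\<close> tends to a finite \<open>r > 0\<close>, the quotients \<open>c n = k n / n\<close> satisfy
  \<open>c n * (c (k n) + r) \<approx> 1\<close>. Their limes superior \<open>L\<close> and limes inferior \<open>l\<close> therefore satisfy
  \<open>L * (l + r) \<le> 1 \<le> l * (L + r)\<close>, hence \<open>L = l\<close>. The case \<open>r < 0\<close> follows by exchanging the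
  letters, and for \<open>r = 0\<close> the value \<open>2 n\<close> lies within distance 1 of the interval spanned by
  \<open>f n\<close> and \<open>g n\<close>.\<close>

section \<open>Counting in complementary sets of natural numbers\<close>

lemma card_below_enumerate:
  fixes S :: "nat set"
  assumes "infinite S"
  shows "card {i \<in> S. i < enumerate S n} = n"
proof -
  have "{i \<in> S. i < enumerate S n} = enumerate S ` {..<n}"
    using assms enumerate_Ex[of S] by (force simp: enumerate_in_set)
  then show ?thesis
    using assms by (simp add: card_image inj_on_def strict_mono_eq[OF strict_mono_enumerate])
qed

lemma enumerate_less_iff_card:
  fixes S :: "nat set"
  assumes "infinite S"
  shows "enumerate S n < m \<longleftrightarrow> n < card {i \<in> S. i < m}"
proof
  assume *: "enumerate S n < m"
  have "{i \<in> S. i < enumerate S n} \<subset> {i \<in> S. i < m}"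
    using * enumerate_in_set[OF assms, of n] by force
  then show "n < card {i \<in> S. i < m}"
    using psubset_card_mono[of "{i \<in> S. i < m}" "{i \<in> S. i < enumerate S n}"]
      card_below_enumerate[OF assms, of n] by simp
next
  assume *: "n < card {i \<in> S. i < m}"
  show "enumerate S n < m"
  proof (rule ccontr)
    assume "\<not> enumerate S n < m"
    then have "card {i \<in> S. i < m} \<le> card {i \<in> S. i < enumerate S n}"
      by (intro card_mono) auto
    then show False
      using * card_below_enumerate[OF assms, of n] by simp
  qed
qed

text \<open>The numbers below \<open>m = enumerate T i\<close> split into the first \<open>i\<close>
  elements of \<open>T\<close> and \<open>m - i\<close> elements of \<open>S\<close>. Hence
  \<open>enumerate S j\<close> lies below \<open>m\<close> exactly when
  \<open>j < m - i\<close>.\<close>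

lemma enumerate_less_enumerate_complement_iff:
  fixes S T :: "nat set"
  assumes "infinite S" "infinite T" "T = - S"
  shows "enumerate S j < enumerate T i \<longleftrightarrow> i + j < enumerate T i"
proof -
  let ?m = "enumerate T i"
  have "{..<?m} = {x \<in> S. x < ?m} \<union> {x \<in> T. x < ?m}"
    using assms by auto
  moreover have "{x \<in> S. x < ?m} \<inter> {x \<in> T. x < ?m} = {}"
    using assms by auto
  ultimately have "?m = card {x \<in> S. x < ?m} + card {x \<in> T. x < ?m}"
    by (metis card_Un_disjoint card_lessThan finite_Un finite_lessThan)
  then show ?thesis
    using enumerate_less_iff_card[OF assms(1), of j ?m] card_below_enumerate[OF assms(2), of i]
    by linarith
qed

section \<open>Complementary sequences and the counting function\<close>

text \<open>The sequences are indexed from 1; the values at 0 are irrelevant.\<close>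

locale complementary =
  fixes f g :: "nat \<Rightarrow> nat"
  assumes less_iff: "\<lbrakk>1 \<le> i; 1 \<le> j\<rbrakk> \<Longrightarrow> f j < g i \<longleftrightarrow> i + j \<le> g i + 1"
    and greater_iff: "\<lbrakk>1 \<le> i; 1 \<le> j\<rbrakk> \<Longrightarrow> g i < f j \<longleftrightarrow> i + j \<le> f j + 1"
    and distinct: "\<lbrakk>1 \<le> i; 1 \<le> j\<rbrakk> \<Longrightarrow> f j \<noteq> g i"
    and ge: "i \<le> f i + 1" "i \<le> g i + 1"
begin

text \<open>Exchanging the letters permutes the axioms, so every passage from \<open>f\<close> to
  \<open>g\<close> can also be used from \<open>g\<close> to \<open>f\<close>.\<close>

lemma swap: "complementary g f"
  using less_iff greater_iff distinct ge
  by unfold_locales (simp_all add: add.commute, metis)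

text \<open>By \<open>ge\<close>, the subtraction on naturals is never truncated.\<close>

definition k :: "nat \<Rightarrow> nat" where "k n = g n + 1 - n"

lemma g_eq: "real (g n) = real (k n) + real n - 1"
  using ge(2)[of n] by (simp add: k_def)

text \<open>The index \<open>j = k n\<close> turns the criterion \<open>n + j \<le> g n + 1\<close>
  of \<open>less_iff\<close> into an equality, so it is the last index with
  \<open>f j < g n\<close>.\<close>

lemma f_k_less: "\<lbrakk>1 \<le> n; 1 \<le> k n\<rbrakk> \<Longrightarrow> f (k n) < g n"
  using less_iff[of n "k n"] by (simp add: k_def)

lemma less_f_Suc_k: "1 \<le> n \<Longrightarrow> g n < f (Suc (k n))"
  using less_iff[of n "Suc (k n)"] distinct[of n "Suc (k n)"] ge(2)[of n]
  by (force simp: k_def)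

lemma k_at_top: "filterlim k at_top sequentially"
  unfolding filterlim_at_top
proof
  fix J
  \<comment> \<open>The summand 2 absorbs the off-by-one in \<open>ge\<close>: from
    \<open>n \<le> g n + 1\<close> it follows that \<open>f (Suc J) < g n\<close>. Using
    \<open>Suc J\<close> keeps the index at least 1.\<close>
  have "\<forall>\<^sub>F n in sequentially. f (Suc J) + 2 \<le> n"
    by (rule eventually_ge_at_top)
  then show "\<forall>\<^sub>F n in sequentially. J \<le> k n"
  proof eventually_elim
    case (elim n)
    then show ?case
      using ge(2)[of n] less_iff[of n "Suc J"] by (simp add: k_def)
  qed
qed

lemma real_k_at_top: "filterlim (\<lambda>n. real (k n)) at_top sequentially"
  by (rule filterlim_compose[OF filterlim_real_sequentially k_at_top])

lemma k_pos: "\<forall>\<^sub>F n in sequentially. 1 \<le> n \<and> 1 \<le> k n"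
  using k_at_top eventually_ge_at_top[of 1] by (auto simp: filterlim_at_top eventually_conj_iff)

lemma inverse_k: "(\<lambda>n. 1 / real (k n)) \<longlonglongrightarrow> 0"
  using tendsto_divide_0[OF tendsto_const filterlim_at_top_imp_at_infinity[OF real_k_at_top]] .

lemma n_over_k: "\<forall>\<^sub>F n in sequentially. real n / real (k n) = real (g n) / real (k n) - 1 + 1 / real (k n)"
  using k_pos by eventually_elim (simp add: g_eq field_simps)

lemma g_over_n: "\<forall>\<^sub>F n in sequentially. 1 + real (k n) / real n - 1 / real n = real (g n) / real n"
  using k_pos by eventually_elim (simp add: g_eq field_simps)

lemma tendsto_g_over_n:
  assumes "(\<lambda>n. real (k n) / real n) \<longlonglongrightarrow> c"
  shows "(\<lambda>n. real (g n) / real n) \<longlonglongrightarrow> 1 + c"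
proof -
  have "(\<lambda>n. 1 + real (k n) / real n - 1 / real n) \<longlonglongrightarrow> 1 + c - 0"
    by (intro tendsto_intros assms lim_1_over_n)
  then show ?thesis
    using Lim_transform_eventually[OF _ g_over_n] by simp
qed

section \<open>From a limit for one letter to a limit for the other\<close>

lemma g_limit_of_finite_f_limit:
  assumes "(\<lambda>n. real (f n) / real n) \<longlonglongrightarrow> x"
  shows "x = 1 \<and> filterlim (\<lambda>n. real (g n) / real n) at_top sequentially
    \<or> 1 < x \<and> (\<lambda>n. real (g n) / real n) \<longlonglongrightarrow> 1 + 1 / (x - 1)"
proof -
  have lo: "(\<lambda>n. real (f (k n)) / real (k n)) \<longlonglongrightarrow> x"
    using filterlim_compose[OF assms k_at_top] .
  have "(\<lambda>n. real (f (Suc (k n))) / real (Suc (k n))) \<longlonglongrightarrow> x"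
    using filterlim_compose[OF LIMSEQ_Suc[OF assms] k_at_top] .
  \<comment> \<open>The extra factor equals \<open>Suc (k n) / k n\<close>; it replaces the
    denominator \<open>Suc (k n)\<close> by \<open>k n\<close> without changing the limit.\<close>
  then have "(\<lambda>n. real (f (Suc (k n))) / real (Suc (k n)) * (1 + 1 / real (k n))) \<longlonglongrightarrow> x * (1 + 0)"
    by (intro tendsto_intros inverse_k)
  then have hi: "(\<lambda>n. real (f (Suc (k n))) / real (Suc (k n)) * (1 + 1 / real (k n))) \<longlonglongrightarrow> x"
    by simp
  have "(\<lambda>n. real (g n) / real (k n)) \<longlonglongrightarrow> x"
  proof (rule tendsto_sandwich[OF _ _ lo hi])
    show "\<forall>\<^sub>F n in sequentially. real (f (k n)) / real (k n) \<le> real (g n) / real (k n)"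
      using k_pos by eventually_elim (simp add: f_k_less divide_right_mono less_imp_le)
    show "\<forall>\<^sub>F n in sequentially. real (g n) / real (k n)
        \<le> real (f (Suc (k n))) / real (Suc (k n)) * (1 + 1 / real (k n))"
      using k_pos
    proof eventually_elim
      case (elim n)
      then have "1 + 1 / real (k n) = real (Suc (k n)) / real (k n)"
        by (simp add: field_simps)
      then have "real (f (Suc (k n))) / real (Suc (k n)) * (1 + 1 / real (k n))
          = real (f (Suc (k n))) / real (k n)"
        by simp
      then show ?case
        using less_f_Suc_k[of n] elim by (simp add: divide_right_mono)
    qed
  qed
  then have "(\<lambda>n. real (g n) / real (k n) - 1 + 1 / real (k n)) \<longlonglongrightarrow> x - 1 + 0"
    by (intro tendsto_intros inverse_k)
  then have nk: "(\<lambda>n. real n / real (k n)) \<longlonglongrightarrow> x - 1"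
    using Lim_transform_eventually[OF _ eventually_mono[OF n_over_k sym]] by simp
  have "0 \<le> x - 1"
    by (rule tendsto_lowerbound[OF nk]) auto
  then consider "x = 1" | "1 < x" by linarith
  then show ?thesis
  proof cases
    case 1
    \<comment> \<open>Here \<open>n / k n\<close> is a positive null sequence, so its reciprocal
      diverges to infinity.\<close>
    have "filterlim (\<lambda>n. inverse (real n / real (k n))) at_top sequentially"
    proof (rule filterlim_inverse_at_top)
      show "(\<lambda>n. real n / real (k n)) \<longlonglongrightarrow> 0" using nk 1 by simp
      show "\<forall>\<^sub>F n in sequentially. 0 < real n / real (k n)"
        using k_pos by eventually_elim auto
    qed
    then have "filterlim (\<lambda>n. real (k n) / real n) at_top sequentially"
      by simp
    then have "filterlim (\<lambda>n. (1 - 1 / real n) + real (k n) / real n) at_top sequentially"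
      by (intro filterlim_tendsto_add_at_top[where c = "1 - 0"] tendsto_intros lim_1_over_n)
    moreover have "\<forall>\<^sub>F n in sequentially.
        (1 - 1 / real n) + real (k n) / real n = real (g n) / real n"
      using g_over_n by eventually_elim simp
    ultimately show ?thesis
      using 1 by (simp cong: filterlim_cong)
  next
    case 2
    have "(\<lambda>n. inverse (real n / real (k n))) \<longlonglongrightarrow> inverse (x - 1)"
      using 2 by (intro tendsto_inverse nk) simp
    then have "(\<lambda>n. real (k n) / real n) \<longlonglongrightarrow> 1 / (x - 1)"
      by (simp add: field_simps)
    then show ?thesis
      using 2 tendsto_g_over_n by blast
  qed
qed

text \<open>The lower bound \<open>f (k n) < g n\<close> alone forces \<open>g n / k n\<close>, and
  with it \<open>n / k n\<close>, to infinity. So \<open>k n / n\<close> tends to 0.\<close>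

lemma g_limit_of_infinite_f_limit:
  assumes "filterlim (\<lambda>n. real (f n) / real n) at_top sequentially"
  shows "(\<lambda>n. real (g n) / real n) \<longlonglongrightarrow> 1"
proof -
  have lo: "filterlim (\<lambda>n. real (f (k n)) / real (k n)) at_top sequentially"
    using filterlim_compose[OF assms k_at_top] .
  have "filterlim (\<lambda>n. real (g n) / real (k n)) at_top sequentially"
  proof (rule filterlim_at_top_mono[OF lo])
    show "\<forall>\<^sub>F n in sequentially. real (f (k n)) / real (k n) \<le> real (g n) / real (k n)"
      using k_pos by eventually_elim (simp add: f_k_less divide_right_mono less_imp_le)
  qed
  then have "filterlim (\<lambda>n. (- 1 + 1 / real (k n)) + real (g n) / real (k n)) at_top sequentially"
    by (intro filterlim_tendsto_add_at_top[where c = "- 1 + 0"] tendsto_intros inverse_k)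
  moreover have "\<forall>\<^sub>F n in sequentially.
      (- 1 + 1 / real (k n)) + real (g n) / real (k n) = real n / real (k n)"
    using n_over_k by eventually_elim simp
  ultimately have "filterlim (\<lambda>n. real n / real (k n)) at_top sequentially"
    by (simp cong: filterlim_cong)
  then have "(\<lambda>n. 1 / (real n / real (k n))) \<longlonglongrightarrow> 0"
    by (intro tendsto_divide_0[OF tendsto_const] filterlim_at_top_imp_at_infinity)
  then show ?thesis
    using tendsto_g_over_n[of 0] by simp
qed

section \<open>Limits from the difference of the positions\<close>

lemma f_limit_of_diff_zero:
  assumes "(\<lambda>n. (real (f n) - real (g n)) / real n) \<longlonglongrightarrow> 0"
  shows "(\<lambda>n. real (f n) / real n) \<longlonglongrightarrow> 2"
proof -
  \<comment> \<open>With both indices equal to \<open>n\<close>, the larger of \<open>f n\<close>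
    and \<open>g n\<close> is at least \<open>2 * n - 1\<close> and the smaller is at most
    \<open>2 * n - 2\<close>.\<close>
  have bound: "\<bar>real (f n) - 2 * real n\<bar> \<le> \<bar>real (f n) - real (g n)\<bar> + 1" if "1 \<le> n" for n
    using less_iff[OF that that] greater_iff[OF that that] distinct[OF that that] by linarith
  have "(\<lambda>n. \<bar>(real (f n) - real (g n)) / real n\<bar> + 1 / real n) \<longlonglongrightarrow> \<bar>0\<bar> + 0"
    by (intro tendsto_intros assms lim_1_over_n)
  then have "(\<lambda>n. \<bar>(real (f n) - real (g n)) / real n\<bar> + 1 / real n) \<longlonglongrightarrow> 0"
    by simp
  then have "(\<lambda>n. real (f n) / real n - 2) \<longlonglongrightarrow> 0"
  proof (rule Lim_null_comparison[rotated])
    show "\<forall>\<^sub>F n in sequentially. norm (real (f n) / real n - 2)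
        \<le> \<bar>(real (f n) - real (g n)) / real n\<bar> + 1 / real n"
      using eventually_ge_at_top[of 1]
    proof eventually_elim
      case (elim n)
      then have "real (f n) / real n - 2 = (real (f n) - 2 * real n) / real n"
        by (simp add: field_simps)
      then have "norm (real (f n) / real n - 2) = \<bar>real (f n) - 2 * real n\<bar> / real n"
        by (simp add: abs_divide)
      also have "\<dots> \<le> (\<bar>real (f n) - real (g n)\<bar> + 1) / real n"
        using bound[OF elim] by (rule divide_right_mono) simp
      finally show ?case
        by (simp add: add_divide_distrib abs_divide)
    qed
  qed
  then show ?thesis
    by (simp add: LIM_zero_iff)
qed

lemma g_convergent_of_diff_pos:
  assumes lim: "(\<lambda>n. (real (f n) - real (g n)) / real n) \<longlonglongrightarrow> r" and "0 < r"
  shows "convergent (\<lambda>n. real (g n) / real n)"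
proof -
  define d where "d n = (real (f n) - real (g n)) / real n" for n
  define c where "c n = real (k n) / real n" for n
  have d: "d \<longlonglongrightarrow> r"
    using lim by (simp add: d_def[abs_def])
  have f_eq: "real (f n) = real n * (c n + d n) + real n - 1" if "1 \<le> n" for n
    using that g_eq[of n] by (simp add: c_def d_def distrib_left)
  \<comment> \<open>Positivity of \<open>r\<close> enters here: eventually \<open>g n < f n\<close>,
    which bounds \<open>k n\<close> by \<open>n\<close>. This makes both the upper and the lower
    limit of \<open>c\<close> real numbers.\<close>
  have c01: "\<forall>\<^sub>F n in sequentially. 0 \<le> c n \<and> c n \<le> 1"
    using order_tendstoD(1)[OF d \<open>0 < r\<close>] eventually_ge_at_top[of 1]
  proof eventually_elim
    case (elim n)
    then have "g n < f n"
      by (simp add: d_def zero_less_divide_iff)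
    then have "\<not> f n < g n" by simp
    then have "k n \<le> n"
      using less_iff[of n n] elim by (simp add: k_def)
    then show ?case
      using elim by (simp add: c_def)
  qed
  define L l where "L = limsup (\<lambda>n. ereal (c n))" and "l = liminf (\<lambda>n. ereal (c n))"
  have "0 \<le> l"
    unfolding l_def by (rule Liminf_bounded) (use c01 in \<open>auto elim: eventually_mono\<close>)
  moreover have "L \<le> 1"
    unfolding L_def by (rule Limsup_bounded) (use c01 in \<open>auto elim: eventually_mono\<close>)
  moreover have "l \<le> L"
    unfolding l_def L_def by (rule Liminf_le_Limsup) simp
  ultimately obtain L' l' where L': "L = ereal L'" "l = ereal l'" "0 \<le> l'"
    by (cases L; cases l) auto
  \<comment> \<open>Bounds by upper and lower limits hold eventually only up to a slack
    \<open>e\<close>. The condition \<open>2 * e < r\<close> keeps the factor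
    \<open>l' + r - 2 * e\<close> positive.\<close>
  have upper: "(L' - e) * (l' + r - 2 * e) \<le> 1" and lower: "1 - e \<le> (l' + 2 * e) * (L' + r + 2 * e)"
    if e: "0 < e" "2 * e < r" for e
  proof -
    have "l - ereal e < l" "L < L + ereal e"
      using e L' by auto
    then have "\<forall>\<^sub>F n in sequentially. l - ereal e < ereal (c n)"
      "\<forall>\<^sub>F n in sequentially. ereal (c n) < L + ereal e"
      unfolding l_def L_def by (intro less_LiminfD Limsup_lessD; simp)+
    moreover have "\<forall>\<^sub>F n in sequentially. r - e < d n" "\<forall>\<^sub>F n in sequentially. d n < r + e"
      using order_tendstoD[OF d] e by simp_all
    ultimately have ev: "\<forall>\<^sub>F n in sequentially. l' + r - 2 * e < c n + d n \<and> c n + d n < L' + r + 2 * e"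
      by eventually_elim (simp add: L')
    have ev_k: "\<forall>\<^sub>F n in sequentially. l' + r - 2 * e < c (k n) + d (k n)"
      and ev_Suc: "\<forall>\<^sub>F n in sequentially. c (Suc (k n)) + d (Suc (k n)) < L' + r + 2 * e"
      using eventually_compose_filterlim[OF ev k_at_top]
        eventually_compose_filterlim[OF ev filterlim_compose[OF filterlim_Suc k_at_top]]
      by (auto elim: eventually_mono)
    have "\<forall>\<^sub>F n in sequentially. c n * (l' + r - 2 * e) \<le> 1"
      using ev_k k_pos
    proof eventually_elim
      case (elim n)
      have "real (f (k n)) + 1 \<le> real (g n)"
        using f_k_less[of n] elim by linarith
      then have "real (k n) * (c (k n) + d (k n)) \<le> real n"
        using f_eq[of "k n"] g_eq[of n] elim by simp
      moreover have "real (k n) * (l' + r - 2 * e) \<le> real (k n) * (c (k n) + d (k n))"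
        using elim by (intro mult_left_mono) auto
      ultimately have "real (k n) * (l' + r - 2 * e) \<le> real n"
        by linarith
      then show ?case
        using elim by (simp add: c_def field_simps)
    qed
    \<comment> \<open>Values of \<open>c\<close> near its upper limit need only occur frequently.
      One such \<open>n\<close> satisfying the eventual bound suffices, since the estimate sought no
      longer involves \<open>n\<close>.\<close>
    moreover have "\<exists>\<^sub>F n in sequentially. L' - e < c n"
    proof (rule ccontr)
      assume "\<not> ?thesis"
      then have "\<forall>\<^sub>F n in sequentially. ereal (c n) \<le> ereal (L' - e)"
        by (simp add: not_frequently not_less)
      then have "L \<le> ereal (L' - e)"
        unfolding L_def by (rule Limsup_bounded)
      then show False
        using L' e by simp
    qed
    ultimately obtain n where "L' - e < c n" "c n * (l' + r - 2 * e) \<le> 1"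
      by (metis (mono_tags, lifting) frequently_eventually_frequently frequently_ex)
    moreover have "(L' - e) * (l' + r - 2 * e) \<le> c n * (l' + r - 2 * e)"
      using \<open>L' - e < c n\<close> e \<open>0 \<le> l'\<close> by (intro mult_right_mono) auto
    ultimately show "(L' - e) * (l' + r - 2 * e) \<le> 1"
      by linarith
    have "0 \<le> L'"
      using \<open>l \<le> L\<close> L' by simp
    \<comment> \<open>Dividing \<open>Suc (k n)\<close> by \<open>n\<close> gives
      \<open>c n + 1 / n\<close>; eventually \<open>1 / n < e\<close>, which accounts for
      \<open>e\<close> on both sides.\<close>
    have "\<forall>\<^sub>F n in sequentially. 1 - e \<le> (c n + e) * (L' + r + 2 * e)"
      using ev_Suc k_pos order_tendstoD(2)[OF lim_1_over_n \<open>0 < e\<close>]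
    proof eventually_elim
      case (elim n)
      have "real (g n) + 1 \<le> real (f (Suc (k n)))"
        using less_f_Suc_k[of n] elim by linarith
      then have "real n - 1 \<le> real (Suc (k n)) * (c (Suc (k n)) + d (Suc (k n)))"
        using f_eq[of "Suc (k n)"] g_eq[of n] by simp
      also have "\<dots> \<le> real (Suc (k n)) * (L' + r + 2 * e)"
        using elim by (intro mult_left_mono) auto
      finally have "(real n - 1) / real n \<le> real (Suc (k n)) * (L' + r + 2 * e) / real n"
        by (rule divide_right_mono) simp
      moreover have "real (Suc (k n)) * (L' + r + 2 * e) / real n = (c n + 1 / real n) * (L' + r + 2 * e)"
        by (simp add: c_def add.commute flip: add_divide_distrib)
      ultimately have "1 - 1 / real n \<le> (c n + 1 / real n) * (L' + r + 2 * e)"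
        using elim by (simp add: diff_divide_distrib)
      also have "\<dots> \<le> (c n + e) * (L' + r + 2 * e)"
        using elim e \<open>0 \<le> L'\<close> by (intro mult_right_mono) auto
      finally show ?case
        using elim by linarith
    qed
    moreover have "\<exists>\<^sub>F n in sequentially. c n < l' + e"
    proof (rule ccontr)
      assume "\<not> ?thesis"
      then have "\<forall>\<^sub>F n in sequentially. ereal (l' + e) \<le> ereal (c n)"
        by (simp add: not_frequently not_less)
      then have "ereal (l' + e) \<le> l"
        unfolding l_def by (rule Liminf_bounded)
      then show False
        using L' e by simp
    qed
    ultimately obtain m where "c m < l' + e" "1 - e \<le> (c m + e) * (L' + r + 2 * e)"
      by (metis (mono_tags, lifting) frequently_eventually_frequently frequently_ex)
    moreover have "(c m + e) * (L' + r + 2 * e) \<le> (l' + 2 * e) * (L' + r + 2 * e)"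
      using \<open>c m < l' + e\<close> e \<open>0 \<le> L'\<close> by (intro mult_right_mono) auto
    ultimately show "1 - e \<le> (l' + 2 * e) * (L' + r + 2 * e)"
      by linarith
  qed
  have small: "\<forall>\<^sub>F e in at_right 0. 0 < e \<and> 2 * e < r"
    using eventually_at_right_real[of 0 "r / 2"] \<open>0 < r\<close> by (auto elim!: eventually_mono)
  have "((\<lambda>e. (L' - e) * (l' + r - 2 * e)) \<longlongrightarrow> (L' - 0) * (l' + r - 2 * 0)) (at_right 0)"
    by (intro tendsto_intros)
  then have "(L' - 0) * (l' + r - 2 * 0) \<le> 1"
    by (rule tendsto_upperbound) (use small upper in \<open>auto elim!: eventually_mono\<close>)
  \<comment> \<open>The term \<open>e\<close> is moved to the right-hand side so that the lower
    bound is the constant 1 as \<open>e\<close> tends to 0.\<close>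
  moreover have "((\<lambda>e. (l' + 2 * e) * (L' + r + 2 * e) + e) \<longlongrightarrow> (l' + 2 * 0) * (L' + r + 2 * 0) + 0)
      (at_right 0)"
    by (intro tendsto_intros)
  then have "1 \<le> (l' + 2 * 0) * (L' + r + 2 * 0) + 0"
    by (rule tendsto_lowerbound) (use small lower in \<open>fastforce elim!: eventually_mono\<close>, simp)
  \<comment> \<open>The common product \<open>L' * l'\<close> cancels between the two limiting
    inequalities.\<close>
  ultimately have "r * L' \<le> r * l'"
    by (simp add: algebra_simps)
  then have "L' \<le> l'"
    using \<open>0 < r\<close> by simp
  then have "l = L"
    using \<open>l \<le> L\<close> L' by simp
  then have "(\<lambda>n. ereal (c n)) \<longlonglongrightarrow> ereal L'"
    using L' unfolding l_def L_def by (intro Liminf_eq_Limsup) simp_all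
  then have "c \<longlonglongrightarrow> L'"
    by simp
  then show ?thesis
    using tendsto_g_over_n unfolding c_def convergent_def by blast
qed

end

section \<open>Conjugate pairs in the extended reals\<close>

text \<open>These are the Hoelder conjugate exponents: for reals above 1,
  \<open>(x - 1) * (y - 1) = 1\<close> is equivalent to \<open>1 / x + 1 / y = 1\<close>. The
  product form matches the limit \<open>1 + 1 / (x - 1)\<close>, and listing the infinite pairs
  separately rules out \<infinity> - \<infinity>.\<close>

definition conjugate :: "ereal \<Rightarrow> ereal \<Rightarrow> bool" where
  "conjugate p q \<longleftrightarrow> p = \<infinity> \<and> q = 1 \<or> p = 1 \<and> q = \<infinity>
    \<or> (\<exists>x y. p = ereal x \<and> q = ereal y \<and> 1 < x \<and> 1 < y \<and> (x - 1) * (y - 1) = 1)"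

lemma conjugate_commute: "conjugate p q \<Longrightarrow> conjugate q p"
  by (force simp: conjugate_def mult.commute)

lemma (in complementary) conjugate_limit:
  assumes "(\<lambda>n. ereal (real (f n) / real n)) \<longlonglongrightarrow> p"
  shows "\<exists>q. (\<lambda>n. ereal (real (g n) / real n)) \<longlonglongrightarrow> q \<and> conjugate p q"
proof (cases p)
  case (real x)
  then have "(\<lambda>n. real (f n) / real n) \<longlonglongrightarrow> x"
    using assms by simp
  from g_limit_of_finite_f_limit[OF this] show ?thesis
  proof
    assume "x = 1 \<and> filterlim (\<lambda>n. real (g n) / real n) at_top sequentially"
    then show ?thesis
      using real by (intro exI[of _ "\<infinity>"]) (simp add: conjugate_def tendsto_PInfty_eq_at_top)
  next
    assume "1 < x \<and> (\<lambda>n. real (g n) / real n) \<longlonglongrightarrow> 1 + 1 / (x - 1)"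
    then show ?thesis
      using real by (intro exI[of _ "ereal (1 + 1 / (x - 1))"]) (auto simp: conjugate_def)
  qed
next
  case PInf
  then have "filterlim (\<lambda>n. real (f n) / real n) at_top sequentially"
    using assms by (simp add: tendsto_PInfty_eq_at_top)
  from g_limit_of_infinite_f_limit[OF this] show ?thesis
    using PInf by (intro exI[of _ 1]) (simp add: conjugate_def one_ereal_def)
next
  case MInf
  have "0 \<le> p"
    by (rule tendsto_lowerbound[OF assms]) auto
  then show ?thesis
    using MInf by simp
qed

lemma (in complementary) f_convergent_of_diff:
  assumes "convergent (\<lambda>n. ereal ((real (f n) - real (g n)) / real n))"
  shows "\<exists>p. (\<lambda>n. ereal (real (f n) / real n)) \<longlonglongrightarrow> p"
proof -
  interpret swapped: complementary g f by (rule swap)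
  obtain r where r: "(\<lambda>n. ereal ((real (f n) - real (g n)) / real n)) \<longlonglongrightarrow> r"
    using assms by (auto simp: convergent_def)
  show ?thesis
  proof (cases r)
    case (real x)
    then have x: "(\<lambda>n. (real (f n) - real (g n)) / real n) \<longlonglongrightarrow> x"
      using r by simp
    consider "x = 0" | "0 < x" | "x < 0" by linarith
    then show ?thesis
    proof cases
      case 1
      then have "(\<lambda>n. ereal (real (f n) / real n)) \<longlonglongrightarrow> ereal 2"
        using f_limit_of_diff_zero x by simp
      then show ?thesis ..
    next
      case 2
      obtain y where "(\<lambda>n. real (g n) / real n) \<longlonglongrightarrow> y"
        using g_convergent_of_diff_pos[OF x 2] by (auto simp: convergent_def)
      then show ?thesis
        using swapped.conjugate_limit[of "ereal y"] by auto
    next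
      case 3
      have "(\<lambda>n. (real (g n) - real (f n)) / real n) \<longlonglongrightarrow> - x"
        using tendsto_minus[OF x] by (simp add: diff_divide_distrib)
      then obtain y where "(\<lambda>n. real (f n) / real n) \<longlonglongrightarrow> y"
        using swapped.g_convergent_of_diff_pos 3 unfolding convergent_def by fastforce
      then have "(\<lambda>n. ereal (real (f n) / real n)) \<longlonglongrightarrow> ereal y"
        by simp
      then show ?thesis ..
    qed
  next
    case PInf
    \<comment> \<open>As \<open>g n\<close> is nonnegative, \<open>f n / n\<close> dominates the
      difference quotient.\<close>
    have "(\<lambda>n. ereal (real (f n) / real n)) \<longlonglongrightarrow> \<infinity>"
      using r unfolding PInf tendsto_PInfty_eq_at_top
      by (rule filterlim_at_top_mono) (simp add: divide_right_mono)
    then show ?thesis ..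
  next
    case MInf
    have "filterlim (\<lambda>n. (real (g n) - real (f n)) / real n) at_top sequentially"
      using tendsto_uminus_ereal[OF r] unfolding MInf
      by (simp add: tendsto_PInfty_eq_at_top diff_divide_distrib)
    then have "(\<lambda>n. ereal (real (g n) / real n)) \<longlonglongrightarrow> \<infinity>"
      unfolding tendsto_PInfty_eq_at_top
      by (rule filterlim_at_top_mono) (simp add: divide_right_mono)
    then show ?thesis
      using swapped.conjugate_limit by blast
  qed
qed

lemma conjugate_inverse_sum:
  assumes "conjugate p q"
  shows "1 / p + 1 / q = 1"
proof -
  have "1 / x + 1 / y = 1" if "1 < x" "1 < y" "(x - 1) * (y - 1) = 1" for x y :: real
    using that by (simp add: field_simps)
  then show ?thesis
    using assms by (auto simp: conjugate_def one_ereal_def divide_ereal_def inverse_eq_divide)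
qed

text \<open>For a finite pair the square root equals \<open>x + y - 2\<close>, so the formulas
  collapse to \<open>x\<close> and \<open>y\<close>. For an infinite pair, \<open>p - q\<close> is
  infinite and \<open>ereal_extend\<close> takes the limits of the formulas.\<close>

lemma conjugate_closed_forms:
  assumes "conjugate p q"
  shows "p = ereal_extend (\<lambda>x. (2 + x + sqrt (4 + x\<^sup>2)) / 2) (p - q)"
    and "q = ereal_extend (\<lambda>x. (2 - x + sqrt (4 + x\<^sup>2)) / 2) (p - q)"
proof -
  let ?P = "\<lambda>x::real. (2 + x + sqrt (4 + x\<^sup>2)) / 2" and ?Q = "\<lambda>x::real. (2 - x + sqrt (4 + x\<^sup>2)) / 2"
  have "filterlim ?P at_top at_top" "(?Q \<longlongrightarrow> 1) at_top" "(?P \<longlongrightarrow> 1) at_bot" "filterlim ?Q at_top at_bot"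
    by real_asymp+
  then have "((\<lambda>x. ereal (?P x)) \<longlongrightarrow> \<infinity>) at_top" "((\<lambda>x. ereal (?Q x)) \<longlongrightarrow> 1) at_top"
    "((\<lambda>x. ereal (?P x)) \<longlongrightarrow> 1) at_bot" "((\<lambda>x. ereal (?Q x)) \<longlongrightarrow> \<infinity>) at_bot"
    by (simp_all add: tendsto_PInfty_eq_at_top one_ereal_def)
  then have lims: "Lim at_top (\<lambda>x. ereal (?P x)) = \<infinity>" "Lim at_top (\<lambda>x. ereal (?Q x)) = 1"
    "Lim at_bot (\<lambda>x. ereal (?P x)) = 1" "Lim at_bot (\<lambda>x. ereal (?Q x)) = \<infinity>"
    by (simp_all add: tendsto_Lim)
  have sqrt: "sqrt (4 + (x - y)\<^sup>2) = x + y - 2" if "1 < x" "1 < y" "(x - 1) * (y - 1) = 1" for x y :: real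
  proof -
    \<comment> \<open>Multiplying the constant 4 by \<open>(x - 1) * (y - 1) = 1\<close> completes
      the square; its root \<open>x + y - 2\<close> is positive.\<close>
    have "4 + (x - y)\<^sup>2 = 4 * ((x - 1) * (y - 1)) + (x - y)\<^sup>2"
      using that by simp
    also have "\<dots> = (x + y - 2)\<^sup>2"
      by (simp add: power2_eq_square algebra_simps)
    finally show ?thesis
      using that by (simp add: real_sqrt_abs)
  qed
  have inf: "\<infinity> - 1 = (\<infinity>::ereal)" "1 - \<infinity> = (- \<infinity>::ereal)"
    by (simp_all add: one_ereal_def)
  consider "p = \<infinity>" "q = 1" | "p = 1" "q = \<infinity>"
    | x y where "p = ereal x" "q = ereal y" "1 < x" "1 < y" "(x - 1) * (y - 1) = 1"
    using assms by (auto simp: conjugate_def)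
  note cases = this
  show "p = ereal_extend ?P (p - q)"
    by (cases rule: cases) (simp_all add: inf ereal_extend_def lims sqrt flip: infinity_ereal_def)
  show "q = ereal_extend ?Q (p - q)"
    by (cases rule: cases) (simp_all add: inf ereal_extend_def lims sqrt flip: infinity_ereal_def)
qed

section \<open>Application to words\<close>

lemma complementary_positions:
  assumes "w \<in> words_W"
  shows "complementary (p_b w) (p_a w)"
proof -
  let ?A = "{i. w i = LetA}" and ?B = "{i. w i = LetB}"
  have inf: "infinite ?A" "infinite ?B"
    using assms by (auto simp: words_W_def)
  have compl: "?A = - ?B" "?B = - ?A"
    by (auto intro: letter.exhaust)
  \<comment> \<open>Counting occurrences from 1 shifts both indices:
    \<open>(i - 1) + (j - 1) < m\<close> becomes \<open>i + j \<le> m + 1\<close>.\<close>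
  have "p_b w j < p_a w i \<longleftrightarrow> i + j \<le> p_a w i + 1"
    "p_a w i < p_b w j \<longleftrightarrow> i + j \<le> p_b w j + 1" if "1 \<le> i" "1 \<le> j" for i j
    using enumerate_less_enumerate_complement_iff[OF inf(2,1) compl(1), of "j - 1" "i - 1"]
      enumerate_less_enumerate_complement_iff[OF inf compl(2), of "i - 1" "j - 1"] that
    unfolding p_a_def p_b_def nth_pos_def by linarith+
  moreover have "p_b w j \<noteq> p_a w i" for i j
    using enumerate_in_set[OF inf(1), of "i - 1"] enumerate_in_set[OF inf(2), of "j - 1"]
    by (auto simp: p_a_def p_b_def nth_pos_def)
  moreover have "i \<le> p_b w i + 1" "i \<le> p_a w i + 1" for i
    using le_enumerate[OF inf(1), of "i - 1"] le_enumerate[OF inf(2), of "i - 1"]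
    by (simp_all add: p_a_def p_b_def nth_pos_def)
  ultimately show ?thesis
    by unfold_locales
qed

theorem theorem3p10:
  fixes w :: "nat \<Rightarrow> letter"
  assumes "w \<in> words_W"
    and "convergent (\<lambda>n. ereal (real_of_int (r_diff w n) / real n))
       \<or> convergent (\<lambda>n. ereal (real (p_b w n) / real n))
       \<or> convergent (\<lambda>n. ereal (real (p_a w n) / real n))"
  shows "\<exists>r p q :: ereal.
      (\<lambda>n. ereal (real_of_int (r_diff w n) / real n)) \<longlonglongrightarrow> r
    \<and> (\<lambda>n. ereal (real (p_b w n) / real n)) \<longlonglongrightarrow> p
    \<and> (\<lambda>n. ereal (real (p_a w n) / real n)) \<longlonglongrightarrow> q
    \<and> 1 / p + 1 / q = 1
    \<and> p = ereal_extend (\<lambda>x. (2 + x + sqrt (4 + x\<^sup>2)) / 2) r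
    \<and> q = ereal_extend (\<lambda>x. (2 - x + sqrt (4 + x\<^sup>2)) / 2) r"
proof -
  interpret complementary "p_b w" "p_a w"
    using assms(1) by (rule complementary_positions)
  interpret swapped: complementary "p_a w" "p_b w"
    by (rule swap)
  have r_eq: "real_of_int (r_diff w n) / real n = (real (p_b w n) - real (p_a w n)) / real n" for n
    by (simp add: r_diff_def)
  \<comment> \<open>Each of the three assumptions yields a limit for one of the letters, and
    \<open>conjugate_limit\<close>, in one of its two orientations, supplies the other.\<close>
  obtain p q where p: "(\<lambda>n. ereal (real (p_b w n) / real n)) \<longlonglongrightarrow> p"
    and q: "(\<lambda>n. ereal (real (p_a w n) / real n)) \<longlonglongrightarrow> q" and pq: "conjugate p q"
    using assms(2) f_convergent_of_diff conjugate_limit swapped.conjugate_limit conjugate_commute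
    unfolding r_eq convergent_def by meson
  \<comment> \<open>A conjugate pair has at most one infinite member, so the difference of the
    limits is well defined.\<close>
  have "(\<lambda>n. ereal (real (p_b w n) / real n) - ereal (real (p_a w n) / real n)) \<longlonglongrightarrow> p - q"
    using p q pq by (intro tendsto_diff_ereal_general) (auto simp: conjugate_def)
  then have "(\<lambda>n. ereal (real_of_int (r_diff w n) / real n)) \<longlonglongrightarrow> p - q"
    by (simp add: r_eq diff_divide_distrib)
  then show ?thesis
    using p q conjugate_inverse_sum[OF pq] conjugate_closed_forms[OF pq] by blast
qed

end
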